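(* For every $\varepsilon>0$ there exists $c(\varepsilon)>0$ with the following property. Let $a_{1}< \ldots < a_{n}$ be $n$ natural numbers. Then $$\sum_{1\leq i<j\leq n}\frac{\gcd(a_{i},a_{j})}{a_{j}}< c(\varepsilon)\,n^{1+\varepsilon}.$$ *)

theory Defs
  imports Complex_Main
begin

end

theory Submission
  imports Defs "HOL-Analysis.Analysis"
begin

text \<open>
  Write \<open>a\<^sub>i = g u\<close> and \<open>a\<^sub>j = g v\<close> with \<open>g\<close> the gcd, so that the summand is \<open>1 / v\<close>, which is at most
  \<open>(u v) powr (- 1/2)\<close>. Summands with \<open>v > n\<close> contribute at most \<open>n\<close> in total. For the others
  \<open>a\<^sub>i v = a\<^sub>j u\<close> with \<open>u, v \<le> n\<close>, so at the cost of a factor \<open>n powr (2 \<delta>)\<close> their sum is at most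
  the squared norm \<open>Q(f)\<close> of the Dirichlet convolution \<open>1\<^sub>A * f\<close>, where
  \<open>f x = x powr - (1/2 + \<delta>)\<close> for \<open>x \<le> n\<close>. By Cauchy--Schwarz \<open>Q(f)\<^sup>2 \<le> n Q(f * f)\<close>, which iterates to
  \<open>Q(f) ^ k \<le> n ^ (k - 1) Q(f * \<dots> * f)\<close> for the \<open>k\<close>-fold convolution, \<open>k = 2 ^ j\<close>. The trivial bound
  \<open>Q(h) \<le> n\<^sup>2 \<Sum> h(x)\<^sup>2\<close> and the divisor bound, which keeps the last sum bounded independently of the
  cutoff, give \<open>Q(f) = O(n powr (1 + 1/k))\<close>.
\<close>

section \<open>The divisor bound: m has \<open>O(m powr \<delta>)\<close> divisors\<close>

lemma card_divisors_mult_le: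
  fixes x y :: nat
  assumes "x > 0" "y > 0"
  shows "card {d. d dvd x * y} \<le> card {d. d dvd x} * card {d. d dvd y}"
proof -
  have fin: "finite {d. d dvd x}" "finite {d. d dvd y}"
    using assms by (auto intro: finite_divisors_nat)
  have "{d. d dvd x * y} \<subseteq> (\<lambda>(b, c). b * c) ` ({d. d dvd x} \<times> {d. d dvd y})"
  proof
    fix d assume "d \<in> {d. d dvd x * y}"
    then obtain b c where "d = b * c" "b dvd x" "c dvd y" using division_decomp[of d x y] by auto
    then show "d \<in> (\<lambda>(b, c). b * c) ` ({d. d dvd x} \<times> {d. d dvd y})"
      by (intro image_eqI[of _ _ "(b, c)"]) auto
  qed
  then have "card {d. d dvd x * y} \<le> card ({d. d dvd x} \<times> {d. d dvd y})"
    using fin by (meson card_image_le card_mono finite_SigmaI finite_imageI order_trans)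
  then show ?thesis by (simp only: card_cartesian_product)
qed

lemma card_divisors_prime_power_le:
  fixes p :: nat
  assumes "prime p"
  shows "card {d. d dvd p ^ k} \<le> k + 1"
proof -
  have "{d. d dvd p ^ k} \<subseteq> (\<lambda>i. p ^ i) ` {..k}"
    using assms by (auto simp: divides_primepow_nat)
  then have "card {d. d dvd p ^ k} \<le> card {..k}"
    by (meson card_image_le card_mono finite_atMost finite_imageI order_trans)
  then show ?thesis by simp
qed

text \<open>The cost of one small prime in the divisor bound, uniform in p and k. It comes from
  \<open>exp t \<ge> 1 + t\<close> at \<open>t = k * \<delta> * ln 2\<close>; the constant is chosen
  so that its product with 1 + t contains k + 1, the other two terms being nonnegative.\<close>

lemma Suc_le_const_mult_powr:
  fixes p :: real
  assumes "\<delta> > 0" "p \<ge> 2"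
  shows "real k + 1 \<le> (1 + 1 / (\<delta> * ln 2)) * p powr (real k * \<delta>)"
proof -
  have pos: "\<delta> * ln 2 > (0::real)" using assms by simp
  have "1 + real k * (\<delta> * ln 2) \<le> exp (real k * (\<delta> * ln 2))"
    by (rule exp_ge_add_one_self)
  also have "\<dots> = 2 powr (real k * \<delta>)" by (simp add: powr_def mult_ac)
  also have "\<dots> \<le> p powr (real k * \<delta>)" using assms by (intro powr_mono2) auto
  finally have "(1 + 1 / (\<delta> * ln 2)) * (1 + real k * (\<delta> * ln 2))
      \<le> (1 + 1 / (\<delta> * ln 2)) * p powr (real k * \<delta>)"
    using pos by (intro mult_left_mono) auto
  moreover have "(1 + 1 / (\<delta> * ln 2)) * (1 + real k * (\<delta> * ln 2))
      = real k + 1 + 1 / (\<delta> * ln 2) + real k * (\<delta> * ln 2)"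
    using assms by (simp add: field_simps)
  moreover have "1 / (\<delta> * ln 2) \<ge> 0" "real k * (\<delta> * ln 2) \<ge> 0" using pos by auto
  ultimately show ?thesis by linarith
qed

text \<open>Only the finitely many primes with \<open>p powr \<delta> < 2\<close> contribute a factor
  \<open>1 + 1 / (\<delta> * ln 2)\<close>: for all others \<open>k + 1 \<le> 2 ^ k \<le> p powr (k * \<delta>)\<close>.\<close>

lemma card_divisors_bound:
  fixes \<delta> :: real
  assumes "\<delta> > 0"
  obtains C where "C > 0" "\<And>m. m > 0 \<Longrightarrow> real (card {d. d dvd m}) \<le> C * real m powr \<delta>"
proof -
  define c where "c = 1 + 1 / (\<delta> * ln (2::real))"
  have c1: "c \<ge> 1" using assms by (simp add: c_def)
  define B where "B = {q::nat. real q powr \<delta> < 2}"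
  have finB: "finite B"
  proof (rule finite_subset)
    show "B \<subseteq> {..nat \<lceil>2 powr (1 / \<delta>)\<rceil>}"
    proof
      fix q assume "q \<in> B"
      then have "(real q powr \<delta>) powr (1 / \<delta>) \<le> 2 powr (1 / \<delta>)"
        using assms by (intro powr_mono2) (auto simp: B_def)
      then have "real q \<le> 2 powr (1 / \<delta>)" using assms by (simp add: powr_powr)
      then show "q \<in> {..nat \<lceil>2 powr (1 / \<delta>)\<rceil>}" by simp linarith
    qed
  qed simp
  \<comment> \<open>Counting only the primes of B that divide m lets the induction charge one factor
    c per small prime; at the end the exponent is enlarged to \<open>card B\<close>, which is
    independent of m.\<close>
  have main: "real (card {d. d dvd m}) \<le> c ^ card {q \<in> B. q dvd m \<and> prime q} * real m powr \<delta>"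
    if "m > 0" for m :: nat
    using that
  proof (induction m rule: less_induct)
    case (less m)
    show ?case
    proof (cases "m = 1")
      case True
      then show ?thesis using c1 by simp
    next
      case False
      then obtain p where p: "prime p" "p dvd m" using prime_factor_nat by blast
      have "\<not> is_unit p" using p by auto
      then obtain t where t: "m = p ^ multiplicity p m * t" "\<not> p dvd t"
        using less.prems by (metis multiplicity_decompose' neq0_conv)
      define k where "k = multiplicity p m"
      have mk: "m = p ^ k * t" using t(1) by (simp add: k_def)
      have p2: "p \<ge> 2" using p prime_ge_2_nat by blast
      have t0: "t > 0" using less.prems mk by (cases t) auto
      have k0: "k > 0" using p less.prems by (simp add: k_def prime_multiplicity_gt_zero_iff)
      have tm: "t < m" using t0 one_less_power[of p k] k0 p2 by (simp add: mk)
      let ?E = "\<lambda>m. {q \<in> B. q dvd m \<and> prime q}"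
      have IH: "real (card {d. d dvd t}) \<le> c ^ card (?E t) * real t powr \<delta>"
        using less.IH[OF tm t0] .
      have sub: "?E t \<subseteq> ?E m" using mk by auto
      have fE: "finite (?E x)" for x using finB by auto
      have pk: "real (p ^ k) powr \<delta> = real p powr (real k * \<delta>)"
        using p2 by (simp add: powr_realpow[symmetric] powr_powr)
      have step: "(real k + 1) * c ^ card (?E t) \<le> c ^ card (?E m) * real (p ^ k) powr \<delta>"
      proof (cases "p \<in> B")
        case True
        \<comment> \<open>Since t is free of p, a small prime p is a new element of
          \<open>?E m\<close>, and this pays for the factor c.\<close>
        have "insert p (?E t) \<subseteq> ?E m" using sub True p by auto
        then have "card (insert p (?E t)) \<le> card (?E m)" using fE by (meson card_mono)
        moreover have "p \<notin> ?E t" using t by auto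
        ultimately have "card (?E t) + 1 \<le> card (?E m)" using fE[of t] by simp
        then have "c ^ (card (?E t) + 1) \<le> c ^ card (?E m)" using c1 by (rule power_increasing)
        moreover have "real k + 1 \<le> c * real p powr (real k * \<delta>)"
          unfolding c_def using assms p2 by (intro Suc_le_const_mult_powr) auto
        then have "(real k + 1) * c ^ card (?E t)
            \<le> (c * real p powr (real k * \<delta>)) * c ^ card (?E t)"
          using c1 by (intro mult_right_mono) auto
        ultimately show ?thesis
          unfolding pk using mult_right_mono[of "c ^ (card (?E t) + 1)" "c ^ card (?E m)"
              "real p powr (real k * \<delta>)"]
          by (simp add: mult_ac)
      next
        case False
        then have "real p powr \<delta> \<ge> 2" by (simp add: B_def)
        then have "2 ^ k \<le> (real p powr \<delta>) ^ k" by (intro power_mono) auto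
        also have "\<dots> = real p powr (real k * \<delta>)"
          using p2 by (simp add: powr_power mult.commute)
        finally have "2 ^ k \<le> real p powr (real k * \<delta>)" .
        moreover have "real k + 1 \<le> 2 ^ k"
          using Suc_leI[OF less_exp[of k]] by (metis Suc_eq_plus1 of_nat_1 of_nat_add
              of_nat_le_iff of_nat_numeral of_nat_power)
        ultimately have "real k + 1 \<le> real p powr (real k * \<delta>)" by linarith
        moreover have "c ^ card (?E t) \<le> c ^ card (?E m)"
          using c1 sub fE by (intro power_increasing card_mono) auto
        ultimately show ?thesis
          unfolding pk using c1 by (simp add: mult.commute mult_mono)
      qed
      have "real (card {d. d dvd m}) \<le> real (card {d. d dvd p ^ k}) * real (card {d. d dvd t})"
        using card_divisors_mult_le[of "p ^ k" t] p2 t0 unfolding mk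
        by (metis less_le_trans of_nat_le_iff of_nat_mult pos2 zero_less_power)
      also have "\<dots> \<le> (real k + 1) * (c ^ card (?E t) * real t powr \<delta>)"
        using card_divisors_prime_power_le[OF p(1), of k] IH by (intro mult_mono) auto
      also have "\<dots> \<le> (c ^ card (?E m) * real (p ^ k) powr \<delta>) * real t powr \<delta>"
        using mult_right_mono[OF step, of "real t powr \<delta>"] by (simp add: mult_ac)
      also have "\<dots> = c ^ card (?E m) * real m powr \<delta>"
        unfolding mk by (simp add: powr_mult)
      finally show ?thesis .
    qed
  qed
  show ?thesis
  proof (rule that[of "c ^ card B"])
    show "c ^ card B > 0" using c1 by simp
    fix m :: nat assume "m > 0"
    then have "real (card {d. d dvd m}) \<le> c ^ card {q \<in> B. q dvd m \<and> prime q} * real m powr \<delta>"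
      by (rule main)
    also have "\<dots> \<le> c ^ card B * real m powr \<delta>"
      using c1 finB by (intro mult_right_mono power_increasing card_mono) auto
    finally show "real (card {d. d dvd m}) \<le> c ^ card B * real m powr \<delta>" .
  qed
qed

section \<open>Dirichlet convolution squares with a cutoff\<close>

text \<open>The Dirichlet convolution with itself of f restricted to {1..M}. It vanishes outside
  {1..M * M}, so the cutoff is squared along with the function.\<close>

definition conv_square :: "nat \<Rightarrow> (nat \<Rightarrow> real) \<Rightarrow> nat \<Rightarrow> real" where
  "conv_square M f m = (\<Sum>(x, y) \<in> {(x, y). x \<in> {1..M} \<and> y \<in> {1..M} \<and> x * y = m}. f x * f y)"

lemma sum_conv_square:
  "(\<Sum>m\<in>{1..M * M}. conv_square M f m * G m) = (\<Sum>x\<in>{1..M}. \<Sum>y\<in>{1..M}. f x * f y * G (x * y))"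
proof -
  have "(\<Sum>m\<in>{1..M * M}. conv_square M f m * G m)
      = (\<Sum>m\<in>{1..M * M}. \<Sum>z\<in>{z \<in> {1..M} \<times> {1..M}. fst z * snd z = m}.
          f (fst z) * f (snd z) * G (fst z * snd z))"
    by (intro sum.cong refl)
      (auto simp: conv_square_def sum_distrib_right case_prod_unfold intro!: sum.cong)
  also have "\<dots> = (\<Sum>z\<in>{1..M} \<times> {1..M}. f (fst z) * f (snd z) * G (fst z * snd z))"
    by (rule sum.group) (auto simp: Suc_le_eq intro: mult_le_mono)
  also have "\<dots> = (\<Sum>x\<in>{1..M}. \<Sum>y\<in>{1..M}. f x * f y * G (x * y))"
    by (simp add: sum.cartesian_product case_prod_unfold)
  finally show ?thesis .
qed

text \<open>A factorisation \<open>m = x * y\<close> is determined by the divisor x and contributes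
  at most \<open>K\<^sup>2 * m powr - \<alpha>\<close>. Squaring thus loses only \<delta> in the
  exponent, and the bound does not depend on M.\<close>

lemma conv_square_bound:
  fixes K C \<alpha> \<delta> :: real
  assumes f: "\<And>x. x \<ge> 1 \<Longrightarrow> 0 \<le> f x" "\<And>x. x \<ge> 1 \<Longrightarrow> f x \<le> K * real x powr - \<alpha>"
    and C: "real (card {d. d dvd m}) \<le> C * real m powr \<delta>"
    and m: "m \<ge> 1"
  shows "conv_square M f m \<le> K\<^sup>2 * C * real m powr - (\<alpha> - \<delta>)"
proof -
  let ?S = "{(x, y). x \<in> {1..M} \<and> y \<in> {1..M} \<and> x * y = m}"
  have "finite {d. d dvd m}" using m by (intro finite_divisors_nat) auto
  moreover have "inj_on fst ?S" by (auto simp: inj_on_def)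
  moreover have "fst ` ?S \<subseteq> {d. d dvd m}" by auto
  ultimately have card: "card ?S \<le> card {d. d dvd m}"
    by (intro card_inj_on_le[of fst])
  have "conv_square M f m \<le> (\<Sum>z\<in>?S. K\<^sup>2 * real m powr - \<alpha>)"
    unfolding conv_square_def
  proof (intro sum_mono, clarify)
    fix x y assume xy: "x \<in> {1..M}" "y \<in> {1..M}" "m = x * y"
    have "f x * f y \<le> (K * real x powr - \<alpha>) * (K * real y powr - \<alpha>)"
      using xy f(1)[of x] f(1)[of y] f(2)[of x] f(2)[of y] by (intro mult_mono) auto
    also have "\<dots> = K\<^sup>2 * real (x * y) powr - \<alpha>"
      by (simp add: powr_mult power2_eq_square)
    finally show "f x * f y \<le> K\<^sup>2 * real (x * y) powr - \<alpha>" .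
  qed
  also have "\<dots> = real (card ?S) * (K\<^sup>2 * real m powr - \<alpha>)" by simp
  also have "\<dots> \<le> (C * real m powr \<delta>) * (K\<^sup>2 * real m powr - \<alpha>)"
    using card C by (intro mult_right_mono) auto
  also have "\<dots> = K\<^sup>2 * C * (real m powr \<delta> * real m powr - \<alpha>)" by simp
  also have "\<dots> = K\<^sup>2 * C * real m powr - (\<alpha> - \<delta>)"
    by (simp add: powr_add[symmetric] add.commute)
  finally show ?thesis .
qed

section \<open>The quadratic form: Cauchy--Schwarz and the trivial bound\<close>

text \<open>The squared \<open>\<ell>\<^sup>2\<close>-norm of the Dirichlet convolution of \<open>f\<close>, cut off at \<open>M\<close>,
  with the indicator function of \<open>A\<close>.\<close>

definition ratio_form :: "nat set \<Rightarrow> nat \<Rightarrow> (nat \<Rightarrow> real) \<Rightarrow> real" where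
  "ratio_form A M f =
    (\<Sum>a\<in>A. \<Sum>b\<in>A. \<Sum>x\<in>{1..M}. \<Sum>y\<in>{1..M}. f x * f y * of_bool (a * x = b * y))"

lemma ratio_form_nonneg:
  assumes "\<And>x. x \<ge> 1 \<Longrightarrow> 0 \<le> f x"
  shows "ratio_form A M f \<ge> 0"
  unfolding ratio_form_def using assms by (intro sum_nonneg mult_nonneg_nonneg) auto

lemma ratio_form_conv_square:
  "ratio_form A (M * M) (conv_square M f) =
    (\<Sum>a\<in>A. \<Sum>b\<in>A. \<Sum>x\<in>{1..M}. \<Sum>y\<in>{1..M}. \<Sum>u\<in>{1..M}. \<Sum>v\<in>{1..M}.
      f x * f y * f u * f v * of_bool (a * (x * y) = b * (u * v)))"
proof -
  have "(\<Sum>x\<in>{1..M * M}. \<Sum>y\<in>{1..M * M}.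
        conv_square M f x * conv_square M f y * of_bool (a * x = b * y))
      = (\<Sum>x\<in>{1..M}. \<Sum>y\<in>{1..M}. \<Sum>u\<in>{1..M}. \<Sum>v\<in>{1..M}.
          f x * f y * f u * f v * of_bool (a * (x * y) = b * (u * v)))" for a b :: nat
  proof -
    \<comment> \<open>The inner sum over y serves as the weight G in \<open>sum_conv_square\<close>;
      the same identity then expands that inner sum.\<close>
    have "(\<Sum>x\<in>{1..M * M}. \<Sum>y\<in>{1..M * M}.
          conv_square M f x * conv_square M f y * of_bool (a * x = b * y))
        = (\<Sum>x\<in>{1..M * M}. conv_square M f x *
            (\<Sum>y\<in>{1..M * M}. conv_square M f y * of_bool (a * x = b * y)))"
      by (simp add: sum_distrib_left mult.assoc del: sum_mult_of_bool_eq sum_of_bool_mult_eq)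
    also have "\<dots> = (\<Sum>x\<in>{1..M}. \<Sum>y\<in>{1..M}. f x * f y *
        (\<Sum>y'\<in>{1..M * M}. conv_square M f y' * of_bool (a * (x * y) = b * y')))"
      by (rule sum_conv_square)
    finally show ?thesis
      unfolding sum_conv_square
      by (simp add: sum_distrib_left mult.assoc del: sum_mult_of_bool_eq sum_of_bool_mult_eq)
  qed
  then show ?thesis unfolding ratio_form_def by simp
qed

text \<open>Cauchy--Schwarz over one of the two elements of A, called c here. Expanding the square
  pairs two solutions \<open>a * x = c * v\<close> and \<open>b * u = c * y\<close> with the same c.
  Eliminating c gives \<open>a * (x * y) = b * (u * v)\<close>, the equation counted by the form of
  the convolution square, and each solution of it comes from at most one c.\<close>

lemma ratio_form_square_le:
  assumes A: "finite A" and f: "\<And>x. x \<ge> 1 \<Longrightarrow> 0 \<le> f x"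
  shows "(ratio_form A M f)\<^sup>2 \<le> real (card A) * ratio_form A (M * M) (conv_square M f)"
proof -
  let ?R = "{1..M}"
  let ?T = "A \<times> ?R \<times> ?R"
  define h where "h = (\<lambda>b (a, x, y). f x * f y * of_bool (a * x = b * y))"
  have "ratio_form A M f = (\<Sum>b\<in>A. \<Sum>a\<in>A. \<Sum>x\<in>?R. \<Sum>y\<in>?R. f x * f y * of_bool (a * x = b * y))"
    unfolding ratio_form_def by (rule sum.swap)
  also have "\<dots> = (\<Sum>b\<in>A. \<Sum>t\<in>?T. h b t)"
    by (simp only: sum.cartesian_product h_def case_prod_unfold fst_conv snd_conv)
  finally have "(ratio_form A M f)\<^sup>2 = (\<Sum>b\<in>A. 1 * (\<Sum>t\<in>?T. h b t))\<^sup>2" by simp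
  also have "\<dots> \<le> (\<Sum>b\<in>A. 1\<^sup>2) * (\<Sum>b\<in>A. (\<Sum>t\<in>?T. h b t)\<^sup>2)"
    by (rule Cauchy_Schwarz_ineq_sum)
  also have "\<dots> = real (card A) * (\<Sum>b\<in>A. \<Sum>s\<in>?T. \<Sum>t\<in>?T. h b s * h b t)"
    by (simp add: power2_eq_square sum_product)
  also have "(\<Sum>b\<in>A. \<Sum>s\<in>?T. \<Sum>t\<in>?T. h b s * h b t) = (\<Sum>s\<in>?T. \<Sum>b\<in>A. \<Sum>t\<in>?T. h b s * h b t)"
    by (rule sum.swap)
  also have "\<dots> = (\<Sum>s\<in>?T. \<Sum>t\<in>?T. \<Sum>b\<in>A. h b s * h b t)"
    by (intro sum.cong refl sum.swap)
  also have "\<dots> \<le> (\<Sum>s\<in>?T. \<Sum>t\<in>?T. (\<lambda>(a, x, v) (b, u, y).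
      f x * f y * f u * f v * of_bool (a * (x * y) = b * (u * v))) s t)"
  proof (intro sum_mono, clarify)
    fix a x v b u y
    assume r: "a \<in> A" "x \<in> ?R" "v \<in> ?R" "b \<in> A" "u \<in> ?R" "y \<in> ?R"
    define F where "F = f x * f y * f u * f v"
    have F: "F \<ge> 0" using r f by (auto simp: F_def)
    have "(\<Sum>c\<in>A. h c (a, x, v) * h c (b, u, y))
        = (\<Sum>c\<in>A. F * of_bool (a * x = c * v \<and> b * u = c * y))"
      by (intro sum.cong refl) (auto simp: h_def F_def)
    also have "\<dots> = F * real (card {c \<in> A. a * x = c * v \<and> b * u = c * y})"
      using A by (simp add: sum_distrib_left[symmetric] of_bool_def sum.If_cases Int_def)
    also have "\<dots> \<le> F * of_bool (a * (x * y) = b * (u * v))"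
    proof (intro mult_left_mono F)
      let ?D = "{c \<in> A. a * x = c * v \<and> b * u = c * y}"
      \<comment> \<open>As v is positive, c can only be the quotient of \<open>a * x\<close> by
        v.\<close>
      have "?D \<subseteq> {a * x div v}" using r by auto
      then have "card ?D \<le> 1" by (metis card_mono finite.emptyI finite_insert is_singletonI is_singleton_altdef)
      moreover have "card ?D = 0" if "a * (x * y) \<noteq> b * (u * v)"
      proof -
        have "a * (x * y) = b * (u * v)" if "c \<in> ?D" for c
        proof -
          have "a * x * y = c * y * v" using that by simp
          also have "c * y * v = b * u * v" using that by simp
          finally show ?thesis by (simp add: mult.assoc)
        qed
        then have "?D = {}" using that by blast
        then show ?thesis by (metis card.empty)
      qed
      ultimately show "real (card ?D) \<le> of_bool (a * (x * y) = b * (u * v))"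
        by (cases "a * (x * y) = b * (u * v)") auto
    qed
    finally show "(\<Sum>c\<in>A. h c (a, x, v) * h c (b, u, y)) \<le>
        f x * f y * f u * f v * of_bool (a * (x * y) = b * (u * v))" by (simp add: F_def)
  qed
  also have "\<dots> = (\<Sum>a\<in>A. \<Sum>x\<in>?R. \<Sum>v\<in>?R. \<Sum>b\<in>A. \<Sum>u\<in>?R. \<Sum>y\<in>?R.
      f x * f y * f u * f v * of_bool (a * (x * y) = b * (u * v)))"
    by (simp only: sum.cartesian_product' case_prod_conv)
  \<comment> \<open>The swaps turn the order a, x, v, b, u, y into a, b, x, y, u, v, as in
    \<open>ratio_form_conv_square\<close>.\<close>
  also have "\<dots> = (\<Sum>a\<in>A. \<Sum>x\<in>?R. \<Sum>b\<in>A. \<Sum>v\<in>?R. \<Sum>u\<in>?R. \<Sum>y\<in>?R.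
      f x * f y * f u * f v * of_bool (a * (x * y) = b * (u * v)))"
    by (intro sum.cong refl sum.swap)
  also have "\<dots> = (\<Sum>a\<in>A. \<Sum>b\<in>A. \<Sum>x\<in>?R. \<Sum>v\<in>?R. \<Sum>u\<in>?R. \<Sum>y\<in>?R.
      f x * f y * f u * f v * of_bool (a * (x * y) = b * (u * v)))"
    by (intro sum.cong refl sum.swap)
  also have "\<dots> = (\<Sum>a\<in>A. \<Sum>b\<in>A. \<Sum>x\<in>?R. \<Sum>v\<in>?R. \<Sum>y\<in>?R. \<Sum>u\<in>?R.
      f x * f y * f u * f v * of_bool (a * (x * y) = b * (u * v)))"
    by (intro sum.cong refl sum.swap)
  also have "\<dots> = (\<Sum>a\<in>A. \<Sum>b\<in>A. \<Sum>x\<in>?R. \<Sum>y\<in>?R. \<Sum>v\<in>?R. \<Sum>u\<in>?R.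
      f x * f y * f u * f v * of_bool (a * (x * y) = b * (u * v)))"
    by (intro sum.cong refl sum.swap)
  also have "\<dots> = (\<Sum>a\<in>A. \<Sum>b\<in>A. \<Sum>x\<in>?R. \<Sum>y\<in>?R. \<Sum>u\<in>?R. \<Sum>v\<in>?R.
      f x * f y * f u * f v * of_bool (a * (x * y) = b * (u * v)))"
    by (intro sum.cong refl sum.swap)
  finally show ?thesis
    unfolding ratio_form_conv_square by (simp add: mult_left_mono)
qed

text \<open>Bound \<open>f x * f y\<close> by the mean of the two squares. For fixed positive a and
  b the equation \<open>a * x = b * y\<close> makes x and y determine each other, so each pair (a,
  b) contributes at most the sum of the squares of f.\<close>

lemma ratio_form_trivial_bound:
  assumes A: "finite A" "0 \<notin> A"
  shows "ratio_form A M f \<le> (real (card A))\<^sup>2 * (\<Sum>x\<in>{1..M}. (f x)\<^sup>2)"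
proof -
  let ?R = "{1..M}"
  let ?S = "\<Sum>x\<in>?R. (f x)\<^sup>2"
  have le: "(\<Sum>x\<in>?R. \<Sum>y\<in>?R. (f x)\<^sup>2 * of_bool (a * x = b * y)) \<le> ?S"
    if "b > 0" for a b
  proof (rule sum_mono)
    fix x assume "x \<in> ?R"
    have "{y \<in> ?R. a * x = b * y} \<subseteq> {a * x div b}" using that by auto
    then have "card {y \<in> ?R. a * x = b * y} \<le> 1"
      by (metis card_mono finite.emptyI finite_insert is_singletonI is_singleton_altdef)
    moreover have "(\<Sum>y\<in>?R. (f x)\<^sup>2 * of_bool (a * x = b * y))
        = (f x)\<^sup>2 * real (card {y \<in> ?R. a * x = b * y})"
      by (simp add: sum_distrib_left[symmetric] of_bool_def sum.If_cases Int_def)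
    ultimately show "(\<Sum>y\<in>?R. (f x)\<^sup>2 * of_bool (a * x = b * y)) \<le> (f x)\<^sup>2"
      by (simp only: mult_left_le of_nat_le_1_iff zero_le_power2)
  qed
  have pair: "(\<Sum>x\<in>?R. \<Sum>y\<in>?R. f x * f y * of_bool (a * x = b * y)) \<le> ?S"
    if "a \<in> A" "b \<in> A" for a b
  proof -
    have pos: "a > 0" "b > 0" using that A by (auto intro: Nat.gr0I)
    have "(\<Sum>x\<in>?R. \<Sum>y\<in>?R. f x * f y * of_bool (a * x = b * y))
        \<le> (\<Sum>x\<in>?R. \<Sum>y\<in>?R. ((f x)\<^sup>2 * of_bool (a * x = b * y)
            + (f y)\<^sup>2 * of_bool (b * y = a * x)) / 2)"
    proof (intro sum_mono)
      fix x y
      have "f x * f y \<le> ((f x)\<^sup>2 + (f y)\<^sup>2) / 2"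
        using sum_squares_bound[of "f x" "f y"] by simp
      then show "f x * f y * of_bool (a * x = b * y) \<le> ((f x)\<^sup>2 * of_bool (a * x = b * y)
            + (f y)\<^sup>2 * of_bool (b * y = a * x)) / 2" by auto
    qed
    also have "\<dots> = ((\<Sum>x\<in>?R. \<Sum>y\<in>?R. (f x)\<^sup>2 * of_bool (a * x = b * y))
        + (\<Sum>x\<in>?R. \<Sum>y\<in>?R. (f y)\<^sup>2 * of_bool (b * y = a * x))) / 2"
      by (simp only: sum.distrib sum_divide_distrib[symmetric])
    also have "(\<Sum>x\<in>?R. \<Sum>y\<in>?R. (f y)\<^sup>2 * of_bool (b * y = a * x))
        = (\<Sum>y\<in>?R. \<Sum>x\<in>?R. (f y)\<^sup>2 * of_bool (b * y = a * x))"
      by (rule sum.swap)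
    finally show ?thesis
      using add_mono[OF le[OF pos(2), of a] le[OF pos(1), of b]]
      by argo
  qed
  have "ratio_form A M f \<le> (\<Sum>a\<in>A. \<Sum>b\<in>A. ?S)"
    unfolding ratio_form_def by (rule sum_mono, rule sum_mono, rule pair)
  then show ?thesis by (simp add: power2_eq_square mult.assoc)
qed

section \<open>Iterating the squaring inequality\<close>

text \<open>Induction on the number of squarings, starting from the trivial bound. C is chosen
  before A, M and f: each step replaces M by M * M and f by its convolution square, so a constant
  depending on the cutoff would be useless. \<alpha> and K change at each step as well, hence are
  generalised.\<close>

lemma ratio_form_power_bound:
  fixes K \<alpha> :: real
  assumes "\<alpha> > 1/2"
  shows "\<exists>C. \<forall>A M f. finite A \<longrightarrow> 0 \<notin> A \<longrightarrow> (\<forall>x\<ge>1. 0 \<le> f x \<and> f x \<le> K * real x powr - \<alpha>) \<longrightarrow>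
    ratio_form A M f ^ 2 ^ j \<le> C * real (card A) ^ (2 ^ j + 1)"
  using assms
proof (induction j arbitrary: \<alpha> K)
  case 0
  \<comment> \<open>The series converges because \<open>2 * \<alpha> > 1\<close>; its full sum
    bounds the truncated sums for every M.\<close>
  define Z where "Z = (\<Sum>x. real x powr - (2 * \<alpha>))"
  have summ: "summable (\<lambda>x. real x powr - (2 * \<alpha>))"
    using 0 by (simp add: summable_real_powr_iff)
  show ?case
  proof (intro exI allI impI)
    fix A :: "nat set" and M and f :: "nat \<Rightarrow> real"
    assume A: "finite A" "0 \<notin> A" and f: "\<forall>x\<ge>1. 0 \<le> f x \<and> f x \<le> K * real x powr - \<alpha>"
    have "(\<Sum>x\<in>{1..M}. (f x)\<^sup>2) \<le> (\<Sum>x\<in>{1..M}. K\<^sup>2 * real x powr - (2 * \<alpha>))"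
    proof (rule sum_mono)
      fix x assume "x \<in> {1..M}"
      then have "(f x)\<^sup>2 \<le> (K * real x powr - \<alpha>)\<^sup>2" using f by (intro power_mono) auto
      also have "\<dots> = K\<^sup>2 * real x powr - (2 * \<alpha>)"
        by (simp add: power_mult_distrib power2_eq_square powr_add[symmetric])
      finally show "(f x)\<^sup>2 \<le> K\<^sup>2 * real x powr - (2 * \<alpha>)" .
    qed
    also have "\<dots> \<le> K\<^sup>2 * Z"
      unfolding sum_distrib_left[symmetric] Z_def
      using summ by (intro mult_left_mono sum_le_suminf) auto
    finally have "(real (card A))\<^sup>2 * (\<Sum>x\<in>{1..M}. (f x)\<^sup>2) \<le> (real (card A))\<^sup>2 * (K\<^sup>2 * Z)"
      by (intro mult_left_mono) auto
    then show "ratio_form A M f ^ 2 ^ 0 \<le> K\<^sup>2 * Z * real (card A) ^ (2 ^ 0 + 1)"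
      using ratio_form_trivial_bound[OF A, of M f] by (simp add: power2_eq_square mult_ac)
  qed
next
  case (Suc j)
  \<comment> \<open>Half the distance from \<alpha> to 1/2, so that the exponent
    \<open>\<alpha> - \<delta>\<close> of the convolution square still exceeds 1/2.\<close>
  define \<delta> where "\<delta> = (\<alpha> - 1/2) / 2"
  have \<delta>: "\<delta> > 0" "\<alpha> - \<delta> > 1/2" using Suc.prems by (auto simp: \<delta>_def field_simps)
  obtain D where D: "D > 0" "\<And>m. m > 0 \<Longrightarrow> real (card {d. d dvd m}) \<le> D * real m powr \<delta>"
    using card_divisors_bound[OF \<delta>(1)] by blast
  obtain C where C: "\<And>(A :: nat set) M f. finite A \<Longrightarrow> 0 \<notin> A \<Longrightarrow>
      (\<forall>x\<ge>1. 0 \<le> f x \<and> f x \<le> K\<^sup>2 * D * real x powr - (\<alpha> - \<delta>)) \<Longrightarrow>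
      ratio_form A M f ^ 2 ^ j \<le> C * real (card A) ^ (2 ^ j + 1)"
    using Suc.IH[OF \<delta>(2), of "K\<^sup>2 * D"] by blast
  show ?case
  proof (intro exI allI impI)
    fix A :: "nat set" and M and f :: "nat \<Rightarrow> real"
    assume A: "finite A" "0 \<notin> A" and f: "\<forall>x\<ge>1. 0 \<le> f x \<and> f x \<le> K * real x powr - \<alpha>"
    let ?n = "real (card A)" and ?g = "conv_square M f"
    have g: "\<forall>x\<ge>1. 0 \<le> ?g x \<and> ?g x \<le> K\<^sup>2 * D * real x powr - (\<alpha> - \<delta>)"
    proof (intro allI impI conjI)
      fix x :: nat assume x: "x \<ge> 1"
      show "0 \<le> ?g x" unfolding conv_square_def using f by (auto intro!: sum_nonneg)
      show "?g x \<le> K\<^sup>2 * D * real x powr - (\<alpha> - \<delta>)"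
        using f D(2)[of x] x by (intro conv_square_bound) auto
    qed
    have "ratio_form A M f ^ 2 ^ Suc j = ((ratio_form A M f)\<^sup>2) ^ 2 ^ j"
      by (simp add: power_mult)
    also have "\<dots> \<le> (?n * ratio_form A (M * M) ?g) ^ 2 ^ j"
      using f by (intro power_mono ratio_form_square_le A) auto
    also have "\<dots> \<le> ?n ^ 2 ^ j * (C * ?n ^ (2 ^ j + 1))"
      unfolding power_mult_distrib using C[OF A g, of "M * M"] by (intro mult_left_mono) auto
    also have "\<dots> = C * ?n ^ (2 ^ Suc j + 1)"
      by (simp add: power_add[symmetric] mult_2)
    finally show "ratio_form A M f ^ 2 ^ Suc j \<le> C * ?n ^ (2 ^ Suc j + 1)" .
  qed
qed

lemma ratio_form_bound:
  fixes \<alpha> \<eta> :: real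
  assumes "\<alpha> > 1/2" "\<eta> > 0"
  obtains C where "C > 0"
    "\<And>(A :: nat set) M n. finite A \<Longrightarrow> 0 \<notin> A \<Longrightarrow> card A \<le> n \<Longrightarrow> n \<ge> 1 \<Longrightarrow>
      ratio_form A M (\<lambda>x. real x powr - \<alpha>) \<le> C * real n powr (1 + \<eta>)"
proof -
  \<comment> \<open>Taking the root of order \<open>2 ^ j\<close> leaves the exponent
    \<open>1 + 1 / 2 ^ j\<close> of n, which must be at most \<open>1 + \<eta>\<close>.\<close>
  obtain j where j: "(1/2) ^ j < \<eta>"
    using assms(2) real_arch_pow_inv[of \<eta> "1/2"] by auto
  define k :: nat where "k = 2 ^ j"
  have k: "k > 0" "1 / real k < \<eta>" using j by (auto simp: k_def power_one_over)
  obtain C0 where C0: "\<And>(A :: nat set) M f. finite A \<Longrightarrow> 0 \<notin> A \<Longrightarrow>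
      (\<forall>x\<ge>1. 0 \<le> f x \<and> f x \<le> 1 * real x powr - \<alpha>) \<Longrightarrow>
      ratio_form A M f ^ k \<le> C0 * real (card A) ^ (k + 1)"
    using ratio_form_power_bound[OF assms(1), of 1 j] unfolding k_def by blast
  \<comment> \<open>The maximum with 1 ensures \<open>C \<le> C ^ k\<close>, so that a k-th root can
    be taken of the whole bound.\<close>
  define C where "C = max C0 1"
  have C: "C \<ge> 1" "C0 \<le> C" by (auto simp: C_def)
  show ?thesis
  proof (rule that[of C])
    show "C > 0" using C by simp
    fix A :: "nat set" and M n :: nat assume A: "finite A" "0 \<notin> A" "card A \<le> n" "n \<ge> 1"
    let ?Q = "ratio_form A M (\<lambda>x. real x powr - \<alpha>)"
    have "?Q ^ k \<le> C0 * real (card A) ^ (k + 1)" using A C0 by simp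
    also have "\<dots> \<le> C * real n ^ (k + 1)"
      using A C by (intro mult_mono power_mono) auto
    also have "\<dots> \<le> C ^ k * real n ^ (k + 1)"
      using C k by (intro mult_right_mono) (auto simp: self_le_power)
    also have "real n ^ (k + 1) = real n powr ((1 + 1 / real k) * real k)"
    proof -
      have "(1 + 1 / real k) * real k = real (k + 1)" using k by (simp add: distrib_right)
      then show ?thesis using A by (simp only: powr_realpow)
    qed
    also have "\<dots> \<le> real n powr ((1 + \<eta>) * real k)"
      using A k by (intro powr_mono mult_right_mono) auto
    also have "\<dots> = (real n powr (1 + \<eta>)) ^ k"
      using A by (simp add: powr_power mult.commute)
    also have "C ^ k * (real n powr (1 + \<eta>)) ^ k = (C * real n powr (1 + \<eta>)) ^ k"
      by (simp add: power_mult_distrib)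
    finally have "?Q ^ k \<le> (C * real n powr (1 + \<eta>)) ^ k"
      using C by (simp add: mult_left_mono)
    then show "?Q \<le> C * real n powr (1 + \<eta>)"
      using C k power_mono_iff[of ?Q "C * real n powr (1 + \<eta>)" k] ratio_form_nonneg
      by simp
  qed
qed

section \<open>From gcd quotients to the quadratic form\<close>

lemma gcd_div_le:
  fixes a b n :: nat and \<delta> :: real
  assumes "0 < a" "a < b" "n \<ge> 1" "\<delta> > 0"
  shows "real (gcd a b) / real b \<le> 1 / real n + real n powr (2 * \<delta>) *
    (\<Sum>x\<in>{1..n}. \<Sum>y\<in>{1..n}. real x powr - (1/2 + \<delta>) * real y powr - (1/2 + \<delta>) *
      of_bool (a * x = b * y))"
proof -
  let ?h = "\<lambda>x y. real x powr - (1/2 + \<delta>) * real y powr - (1/2 + \<delta>) * of_bool (a * x = b * y)"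
  define g where "g = gcd a b"
  have g: "g > 0" using assms by (simp add: g_def)
  obtain u where u: "a = g * u" using g_def by (metis dvd_def gcd_dvd1)
  obtain v where v: "b = g * v" using g_def by (metis dvd_def gcd_dvd2)
  have uv: "0 < u" "u < v" using assms u v g by auto
  have eq: "real (gcd a b) / real b = 1 / real v"
    unfolding g_def[symmetric] using g by (subst v) simp
  have nonneg: "(\<Sum>x\<in>{1..n}. \<Sum>y\<in>{1..n}. ?h x y) \<ge> 0" by (intro sum_nonneg) auto
  show ?thesis
  proof (cases "v \<le> n")
    case False
    then have "1 / real v \<le> 1 / real n" using assms by (simp add: frac_le)
    then show ?thesis unfolding eq using nonneg by (simp add: add_increasing2)
  next
    case True
    have "1 / real v = real v powr (- (1/2) + - (1/2))"
      using uv by (simp add: powr_minus_divide)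
    also have "\<dots> = (real v * real v) powr - (1/2)"
      by (simp only: powr_add powr_mult)
    also have "\<dots> \<le> (real u * real v) powr - (1/2)"
      using uv by (intro powr_mono2') auto
    \<comment> \<open>The exponent is pushed beyond 1/2, as \<open>ratio_form_bound\<close> demands;
      since u and v are at most n, the price is at most
      \<open>n powr (2 * \<delta>)\<close>.\<close>
    also have "\<dots> = (real u * real v) powr \<delta> * (real u * real v) powr - (1/2 + \<delta>)"
      using uv by (simp add: powr_add[symmetric])
    also have "\<dots> \<le> (real n * real n) powr \<delta> * (real u * real v) powr - (1/2 + \<delta>)"
      using uv True assms by (intro mult_right_mono powr_mono2 mult_mono) auto
    also have "\<dots> = real n powr (2 * \<delta>) * ?h v u"
    proof -
      have "(real n * real n) powr \<delta> = real n powr (2 * \<delta>)"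
        using powr_add[of "real n" \<delta> \<delta>] by (simp add: powr_mult)
      \<comment> \<open>The pair (v, u) solves the equation: \<open>a * v\<close> and
        \<open>b * u\<close> both equal \<open>g * u * v\<close>.\<close>
      moreover have "(real u * real v) powr - (1/2 + \<delta>) = ?h v u"
        using u v by (simp add: powr_mult)
      ultimately show ?thesis by simp
    qed
    also have "\<dots> \<le> real n powr (2 * \<delta>) * (\<Sum>x\<in>{1..n}. \<Sum>y\<in>{1..n}. ?h x y)"
    proof (rule mult_left_mono)
      have "?h v u \<le> (\<Sum>y\<in>{1..n}. ?h v y)"
        using uv True by (intro member_le_sum) auto
      also have "\<dots> \<le> (\<Sum>x\<in>{1..n}. \<Sum>y\<in>{1..n}. ?h x y)"
        using uv True by (intro member_le_sum[where f = "\<lambda>x. \<Sum>y\<in>{1..n}. ?h x y"] sum_nonneg) auto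
      finally show "?h v u \<le> (\<Sum>x\<in>{1..n}. \<Sum>y\<in>{1..n}. ?h x y)" .
    qed simp
    finally show ?thesis unfolding eq by (simp add: add_increasing)
  qed
qed

theorem theorem2:
  shows "\<forall>\<epsilon>::real. \<epsilon> > 0 \<longrightarrow>
    (\<exists>c::real. c > 0 \<and>
      (\<forall>(n::nat) (a :: nat \<Rightarrow> nat). n \<ge> 1 \<longrightarrow> strict_mono_on {1..n} a \<longrightarrow>
        (\<Sum>(i, j) \<in> {(i, j). 1 \<le> i \<and> i < j \<and> j \<le> n}. real (gcd (a i) (a j)) / real (a j))
          < c * real n powr (1 + \<epsilon>)))"
proof (intro allI impI)
  fix \<epsilon> :: real assume \<epsilon>: "\<epsilon> > 0"
  \<comment> \<open>The factor \<open>n powr (2 * \<delta>)\<close> takes one half of \<epsilon> and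
    the bound for the form takes the other half.\<close>
  define \<delta> where "\<delta> = \<epsilon> / 4"
  have \<delta>: "\<delta> > 0" using \<epsilon> by (simp add: \<delta>_def)
  obtain C where C: "C > 0"
    "\<And>(A :: nat set) M n. finite A \<Longrightarrow> 0 \<notin> A \<Longrightarrow> card A \<le> n \<Longrightarrow> n \<ge> 1 \<Longrightarrow>
      ratio_form A M (\<lambda>x. real x powr - (1/2 + \<delta>)) \<le> C * real n powr (1 + \<epsilon> / 2)"
    using ratio_form_bound[of "1/2 + \<delta>" "\<epsilon> / 2"] \<epsilon> \<delta> by auto
  show "\<exists>c::real. c > 0 \<and>
      (\<forall>(n::nat) (a :: nat \<Rightarrow> nat). n \<ge> 1 \<longrightarrow> strict_mono_on {1..n} a \<longrightarrow>
        (\<Sum>(i, j) \<in> {(i, j). 1 \<le> i \<and> i < j \<and> j \<le> n}. real (gcd (a i) (a j)) / real (a j))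
          < c * real n powr (1 + \<epsilon>))"
  \<comment> \<open>The form accounts for C and the two elementary contributions for 2; the
    remaining 1 makes the inequality strict.\<close>
  proof (intro exI[of _ "C + 3"] conjI allI impI)
    show "C + 3 > 0" using C by simp
    fix n :: nat and a :: "nat \<Rightarrow> nat"
    assume n: "n \<ge> 1" and mono: "strict_mono_on {1..n} a"
    let ?P = "\<lambda>a b. \<Sum>x\<in>{1..n}. \<Sum>y\<in>{1..n}. real x powr - (1/2 + \<delta>) * real y powr - (1/2 + \<delta>) *
      of_bool (a * x = b * y)"
    define p where "p = (\<lambda>i j. real n powr (2 * \<delta>) * of_bool (i \<ge> 2 \<and> j \<ge> 2) * ?P (a i) (a j))"
    \<comment> \<open>Summed over the square {1..n} \<times> {1..n}, the first two terms give n
      each. The second one covers the pairs with i = 1, whose quotient is at most 1.\<close>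
    let ?t = "\<lambda>i j. 1 / real n + of_bool (i = 1) + p i j"
    let ?S = "{(i, j). 1 \<le> i \<and> i < j \<and> j \<le> n}"
    \<comment> \<open>The index 1 is split off because \<open>a 1\<close> may be 0.\<close>
    have P0: "?P x y \<ge> 0" for x y by (intro sum_nonneg) auto
    have p0: "p i j \<ge> 0" for i j unfolding p_def using P0[of "a i" "a j"] by simp
    have le_t: "real (gcd (a i) (a j)) / real (a j) \<le> ?t i j"
      if "1 \<le> i" "i < j" "j \<le> n" for i j
    proof (cases "i = 1")
      case True
      have "a i < a j" using mono that by (auto simp: strict_mono_on_def)
      then have "real (gcd (a i) (a j)) / real (a j) \<le> 1"
        by (simp add: divide_le_eq_1 gcd_le2_nat)
      then show ?thesis using True p0[of i j] by (simp add: add_increasing add_increasing2)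
    next
      case False
      have "a 1 < a i" "a i < a j" using mono that False by (auto simp: strict_mono_on_def)
      then show ?thesis
        using gcd_div_le[of "a i" "a j" n \<delta>] n \<delta> that False by (simp add: p_def)
    qed
    let ?A = "a ` {2..n}"
    have inj: "inj_on a {2..n}"
      using strict_mono_on_imp_inj_on[OF mono] by (rule inj_on_subset) auto
    have "0 \<notin> ?A"
    proof
      assume "0 \<in> ?A"
      then obtain i where "i \<in> {2..n}" "a i = 0" by auto
      moreover from this have "a 1 < a i" using strict_mono_onD[OF mono, of 1 i] by auto
      ultimately show False by simp
    qed
    then have Q: "ratio_form ?A n (\<lambda>x. real x powr - (1/2 + \<delta>)) \<le> C * real n powr (1 + \<epsilon> / 2)"
      using C(2)[of ?A n n] n card_image_le[of "{2..n}" a] by simp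
    have sub: "{2..n} \<subseteq> {1..n}" by auto
    have "(\<Sum>i\<in>{1..n}. \<Sum>j\<in>{1..n}. p i j) = (\<Sum>i\<in>{2..n}. \<Sum>j\<in>{1..n}. p i j)"
      by (rule sum.mono_neutral_right) (auto simp: p_def)
    also have "\<dots> = (\<Sum>i\<in>{2..n}. \<Sum>j\<in>{2..n}. p i j)"
      by (intro sum.cong refl sum.mono_neutral_right) (auto simp: p_def)
    also have "\<dots> = (\<Sum>i\<in>{2..n}. \<Sum>j\<in>{2..n}. real n powr (2 * \<delta>) * ?P (a i) (a j))"
      by (intro sum.cong refl) (auto simp: p_def)
    also have "\<dots> = real n powr (2 * \<delta>) * ratio_form ?A n (\<lambda>x. real x powr - (1/2 + \<delta>))"
      unfolding ratio_form_def sum_distrib_left[symmetric] using inj by (simp add: sum.reindex)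
    also have "\<dots> \<le> real n powr (2 * \<delta>) * (C * real n powr (1 + \<epsilon> / 2))"
      using Q by (intro mult_left_mono) auto
    also have "\<dots> = C * real n powr (1 + \<epsilon>)"
      by (simp add: powr_add[symmetric] \<delta>_def add.commute)
    finally have psum: "(\<Sum>i\<in>{1..n}. \<Sum>j\<in>{1..n}. p i j) \<le> C * real n powr (1 + \<epsilon>)" .
    have "(\<Sum>(i, j)\<in>?S. real (gcd (a i) (a j)) / real (a j)) \<le> (\<Sum>(i, j)\<in>?S. ?t i j)"
      using le_t by (intro sum_mono) auto
    \<comment> \<open>All terms of the majorant are nonnegative, so the sum may be extended from i <
      j to the full square, where the form lives.\<close>
    also have "\<dots> \<le> (\<Sum>(i, j)\<in>{1..n} \<times> {1..n}. ?t i j)"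
      using p0 by (intro sum_mono2) (auto intro!: add_nonneg_nonneg)
    also have "\<dots> = (\<Sum>i\<in>{1..n}. \<Sum>j\<in>{1..n}. ?t i j)" by (simp add: sum.cartesian_product)
    also have "\<dots> = (\<Sum>i\<in>{1..n}. \<Sum>j\<in>{1..n}. 1 / real n)
        + (\<Sum>i\<in>{1..n}. \<Sum>j\<in>{1..n}. of_bool (i = 1)) + (\<Sum>i\<in>{1..n}. \<Sum>j\<in>{1..n}. p i j)"
      by (simp only: sum.distrib)
    also have "(\<Sum>i\<in>{1..n}. \<Sum>j\<in>{1..n}. 1 / real n) = real n" using n by simp
    also have "(\<Sum>i\<in>{1..n}. \<Sum>j\<in>{1..n}. of_bool (i = 1)) = real n"
      using n by (simp add: sum_distrib_left[symmetric] of_bool_def sum.delta)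
    finally have "(\<Sum>(i, j)\<in>?S. real (gcd (a i) (a j)) / real (a j))
        \<le> 2 * real n + C * real n powr (1 + \<epsilon>)" using psum by linarith
    also have "\<dots> < (C + 3) * real n powr (1 + \<epsilon>)"
    proof -
      have "real n \<le> real n powr (1 + \<epsilon>)"
        using n \<epsilon> powr_mono[of 1 "1 + \<epsilon>" "real n"] by simp
      then show ?thesis using n by (simp add: distrib_right)
    qed
    finally show "(\<Sum>(i, j)\<in>?S. real (gcd (a i) (a j)) / real (a j)) < (C + 3) * real n powr (1 + \<epsilon>)" .
  qed
qed

end
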